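(* Let $J\in\mathbb{R}$, $J\neq0$, $\alpha\in\mathbb{R}$ and $\beta>0$. The Ising model with spin values in $[0,1]$ on the Cayley tree $\Gamma_2$ of order two with $J_1=J_3=0$, i.e. with formal Hamiltonian $$H(\sigma)=-J\sum_{\rangle y,z\langle}\sigma(y)\sigma(z)-\alpha\sum_{x\in V}\sigma(x),$$ where the first sum is over all pairs of second neighbours $\rangle y,z\langle$ (pairs of distinct direct successors of a common vertex), has a unique splitting Gibbs measure.
   Context: The Cayley tree $\Gamma_2=(V,L)$ of order two is the infinite tree in which every vertex has exactly 3 neighbours. Fix a root $x^0$; $d$ is the graph distance, $W_n=\{x\in V: d(x,x^0)=n\}$, $V_n=\{x\in V: d(x,x^0)\le n\}$, and for $x\in W_n$, $S(x)=\{y\in W_{n+1}: d(x,y)=1\}$ is the set of direct successors. For $\sigma\in[0,1]^{V_n}$, $n\ge1$, the Hamiltonian on $V_n$ is $$H(\sigma)=-J\sum_{x\in V_{n-1}}\ \sum_{\{y,z\}\subset S(x),\ y\neq z}\sigma(y)\sigma(z)-\alpha\sum_{x\in V_n}\sigma(x).$$ Let $h:[0,1]\times(V\setminus\{x^0\})\to\mathbb{R}$, $(t,x)\mapsto h_{t,x}$, be measurable and bounded in $t$ for each $x$. For $n\ge1$ let $\mu^{(n)}$ be the probability density on $[0,1]^{V_n}$ with respect to product Lebesgue measure given by $\mu^{(n)}(\sigma_n)=Z_n^{-1}\exp(-\beta H(\sigma_n)+\sum_{x\in W_n}h_{\sigma_n(x),x})$, $Z_n$ the normalizing constant. The densities are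 compatible if for all $n\ge2$ and $\sigma_{n-1}\in[0,1]^{V_{n-1}}$, $\int_{[0,1]^{W_n}}\mu^{(n)}(\sigma_{n-1}\vee\omega_n)\,\lambda_{W_n}(d\omega_n)=\mu^{(n-1)}(\sigma_{n-1})$, where $\lambda_{W_n}$ is product Lebesgue measure and $\vee$ is concatenation. If they are compatible, the unique probability measure $\mu$ on $[0,1]^V$ whose marginal on $[0,1]^{V_n}$ has density $\mu^{(n)}$ for all $n\ge1$ is the splitting Gibbs measure corresponding to $h$. A splitting Gibbs measure of the model is a measure arising in this way from some such $h$. *)

theory Defs
  imports "HOL-Probability.Probability"
begin

section \<open>Cayley trees\<close>

text \<open>Simple graphs are given by a vertex set \<open>V\<close> and a set \<open>L\<close> of two-element
  subsets of \<open>V\<close>. A walk is the nonempty list of its vertices, so a walk of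
  length \<open>n\<close> (number of edges) is a list of length \<open>Suc n\<close>.\<close>

definition simple_graph :: "'v set \<Rightarrow> 'v set set \<Rightarrow> bool" where
  "simple_graph V L \<longleftrightarrow> (\<forall>e\<in>L. e \<subseteq> V \<and> card e = 2)"

definition walk :: "'v set \<Rightarrow> 'v set set \<Rightarrow> 'v list \<Rightarrow> bool" where
  "walk V L xs \<longleftrightarrow> xs \<noteq> [] \<and> set xs \<subseteq> V \<and> successively (\<lambda>x y. {x, y} \<in> L) xs"

definition connected_graph :: "'v set \<Rightarrow> 'v set set \<Rightarrow> bool" where
  "connected_graph V L \<longleftrightarrow>
     V \<noteq> {} \<and> (\<forall>x\<in>V. \<forall>y\<in>V. \<exists>xs. walk V L xs \<and> hd xs = x \<and> last xs = y)"

definition is_cycle :: "'v set \<Rightarrow> 'v set set \<Rightarrow> 'v list \<Rightarrow> bool" where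
  "is_cycle V L xs \<longleftrightarrow>
     walk V L xs \<and> distinct xs \<and> length xs \<ge> 3 \<and> {last xs, hd xs} \<in> L"

definition tree_graph :: "'v set \<Rightarrow> 'v set set \<Rightarrow> bool" where
  "tree_graph V L \<longleftrightarrow>
     simple_graph V L \<and> connected_graph V L \<and> (\<nexists>xs. is_cycle V L xs)"

definition cayley_tree :: "nat \<Rightarrow> 'v set \<Rightarrow> 'v set set \<Rightarrow> bool" where
  "cayley_tree k V L \<longleftrightarrow>
     tree_graph V L \<and> infinite V \<and> (\<forall>x\<in>V. card {y \<in> V. {x, y} \<in> L} = k + 1)"

definition graph_dist :: "'v set \<Rightarrow> 'v set set \<Rightarrow> 'v \<Rightarrow> 'v \<Rightarrow> nat" where
  "graph_dist V L x y =
     (LEAST n. \<exists>xs. walk V L xs \<and> hd xs = x \<and> last xs = y \<and> length xs = Suc n)"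

definition sphere_W :: "'v set \<Rightarrow> 'v set set \<Rightarrow> 'v \<Rightarrow> nat \<Rightarrow> 'v set" where
  "sphere_W V L r n = {x \<in> V. graph_dist V L x r = n}"

definition ball_V :: "'v set \<Rightarrow> 'v set set \<Rightarrow> 'v \<Rightarrow> nat \<Rightarrow> 'v set" where
  "ball_V V L r n = {x \<in> V. graph_dist V L x r \<le> n}"

definition successors :: "'v set \<Rightarrow> 'v set set \<Rightarrow> 'v \<Rightarrow> 'v \<Rightarrow> 'v set" where
  "successors V L r x =
     {y \<in> sphere_W V L r (graph_dist V L x r + 1). graph_dist V L x y = 1}"


section \<open>The model\<close>

text \<open>Configurations on \<open>A \<subseteq> V\<close> are the elements of \<open>A \<rightarrow>\<^sub>E {0..1}\<close>, the space of
  the product measure \<open>spin_space A\<close>. Its \<open>\<sigma>\<close>-algebra is meaningful for every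
  \<open>A\<close>; as a measure it is the product Lebesgue measure and is used only for
  finite \<open>A\<close>.\<close>

definition spin_space :: "'v set \<Rightarrow> ('v \<Rightarrow> real) measure" where
  "spin_space A = (\<Pi>\<^sub>M x\<in>A. restrict_space lborel {0..1})"

text \<open>The inner sum ranges over unordered pairs \<open>p = {y, z}\<close> of distinct direct
  successors, and the product over \<open>p\<close> is \<open>\<sigma> y * \<sigma> z\<close>. Only \<open>n \<ge> 1\<close> is relevant.\<close>

definition hamiltonian ::
  "'v set \<Rightarrow> 'v set set \<Rightarrow> 'v \<Rightarrow> real \<Rightarrow> real \<Rightarrow> nat \<Rightarrow> ('v \<Rightarrow> real) \<Rightarrow> real" where
  "hamiltonian V L r J \<alpha> n \<sigma> =
     - J * (\<Sum>x\<in>ball_V V L r (n - 1).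
              \<Sum>p | p \<subseteq> successors V L r x \<and> card p = 2. \<Prod>y\<in>p. \<sigma> y)
     - \<alpha> * (\<Sum>x\<in>ball_V V L r n. \<sigma> x)"

text \<open>A boundary field is a function \<open>h t x\<close>; only its values for \<open>t \<in> {0..1}\<close> and
  \<open>x \<in> V - {r}\<close> are ever used.\<close>

definition boundary_field :: "'v set \<Rightarrow> 'v \<Rightarrow> (real \<Rightarrow> 'v \<Rightarrow> real) \<Rightarrow> bool" where
  "boundary_field V r h \<longleftrightarrow>
     (\<forall>x\<in>V - {r}. (\<lambda>t. h t x) \<in> borel_measurable (restrict_space borel {0..1}) \<and>
                    bounded ((\<lambda>t. h t x) ` {0..1}))"

definition gibbs_weight ::
  "'v set \<Rightarrow> 'v set set \<Rightarrow> 'v \<Rightarrow> real \<Rightarrow> real \<Rightarrow> real \<Rightarrow> (real \<Rightarrow> 'v \<Rightarrow> real) \<Rightarrow>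
     nat \<Rightarrow> ('v \<Rightarrow> real) \<Rightarrow> real" where
  "gibbs_weight V L r J \<alpha> \<beta> h n \<sigma> =
     exp (- \<beta> * hamiltonian V L r J \<alpha> n \<sigma> + (\<Sum>x\<in>sphere_W V L r n. h (\<sigma> x) x))"

definition partition_function ::
  "'v set \<Rightarrow> 'v set set \<Rightarrow> 'v \<Rightarrow> real \<Rightarrow> real \<Rightarrow> real \<Rightarrow> (real \<Rightarrow> 'v \<Rightarrow> real) \<Rightarrow>
     nat \<Rightarrow> real" where
  "partition_function V L r J \<alpha> \<beta> h n =
     (\<integral>\<sigma>. gibbs_weight V L r J \<alpha> \<beta> h n \<sigma> \<partial>spin_space (ball_V V L r n))"

definition gibbs_density ::
  "'v set \<Rightarrow> 'v set set \<Rightarrow> 'v \<Rightarrow> real \<Rightarrow> real \<Rightarrow> real \<Rightarrow> (real \<Rightarrow> 'v \<Rightarrow> real) \<Rightarrow>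
     nat \<Rightarrow> ('v \<Rightarrow> real) \<Rightarrow> real" where
  "gibbs_density V L r J \<alpha> \<beta> h n \<sigma> =
     gibbs_weight V L r J \<alpha> \<beta> h n \<sigma> / partition_function V L r J \<alpha> \<beta> h n"

text \<open>The library function \<^const>\<open>merge\<close> is the concatenation of configurations
  on disjoint sets.\<close>

definition compatible ::
  "'v set \<Rightarrow> 'v set set \<Rightarrow> 'v \<Rightarrow> real \<Rightarrow> real \<Rightarrow> real \<Rightarrow> (real \<Rightarrow> 'v \<Rightarrow> real) \<Rightarrow> bool" where
  "compatible V L r J \<alpha> \<beta> h \<longleftrightarrow>
     (\<forall>n\<ge>2. \<forall>\<sigma> \<in> ball_V V L r (n - 1) \<rightarrow>\<^sub>E {0..1}.
        (\<integral>\<omega>. gibbs_density V L r J \<alpha> \<beta> h n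
               (merge (ball_V V L r (n - 1)) (sphere_W V L r n) (\<sigma>, \<omega>))
           \<partial>spin_space (sphere_W V L r n))
        = gibbs_density V L r J \<alpha> \<beta> h (n - 1) \<sigma>)"

definition corresponds_to ::
  "'v set \<Rightarrow> 'v set set \<Rightarrow> 'v \<Rightarrow> real \<Rightarrow> real \<Rightarrow> real \<Rightarrow> (real \<Rightarrow> 'v \<Rightarrow> real) \<Rightarrow>
     ('v \<Rightarrow> real) measure \<Rightarrow> bool" where
  "corresponds_to V L r J \<alpha> \<beta> h \<mu> \<longleftrightarrow>
     prob_space \<mu> \<and> sets \<mu> = sets (spin_space V) \<and>
     (\<forall>n\<ge>1. distr \<mu> (spin_space (ball_V V L r n)) (\<lambda>\<sigma>. restrict \<sigma> (ball_V V L r n))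
            = density (spin_space (ball_V V L r n))
                (\<lambda>\<sigma>. ennreal (gibbs_density V L r J \<alpha> \<beta> h n \<sigma>)))"

definition splitting_gibbs_measure ::
  "'v set \<Rightarrow> 'v set set \<Rightarrow> 'v \<Rightarrow> real \<Rightarrow> real \<Rightarrow> real \<Rightarrow> ('v \<Rightarrow> real) measure \<Rightarrow> bool" where
  "splitting_gibbs_measure V L r J \<alpha> \<beta> \<mu> \<longleftrightarrow>
     (\<exists>h. boundary_field V r h \<and> compatible V L r J \<alpha> \<beta> h \<and>
          corresponds_to V L r J \<alpha> \<beta> h \<mu>)"

end

theory Submission imports Defs begin

text \<open>Second neighbours lie in a common sphere, so the Boltzmann weight is a product over the
  spheres \<open>W\<^sub>k\<close> and the spheres are independent. Integrating out the outermost sphere therefore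
  leaves only a constant, and compatibility means that the boundary field is constant on
  configurations of each sphere; it cancels in the normalized density. Hence every splitting Gibbs
  measure has the same marginals as for \<open>h = 0\<close>, and this common measure exists as an
  infinite product over the spheres.\<close>

section \<open>Products of layered families\<close>

text \<open>The layers model the spheres around a root, with \<open>d\<close> in the role of the
  distance to it. Finiteness of each layer makes every \<open>below n\<close> a finite set of
  coordinates.\<close>

locale layered_family =
  fixes M :: "'v \<Rightarrow> 'a measure" and V :: "'v set" and d :: "'v \<Rightarrow> nat"
  assumes prob_M: "\<And>i. prob_space (M i)"
    and finite_layer: "\<And>k. finite {y \<in> V. d y = k}"
begin

definition layer :: "nat \<Rightarrow> 'v set" where "layer k = {y \<in> V. d y = k}"

definition below :: "nat \<Rightarrow> 'v set" where "below n = {y \<in> V. d y \<le> n}"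

lemma finite_layer' [simp]: "finite (layer k)"
  using finite_layer by (simp add: layer_def)

lemma below_0: "below 0 = layer 0"
  by (auto simp: below_def layer_def)

lemma below_Suc: "below (Suc n) = below n \<union> layer (Suc n)"
  by (auto simp: below_def layer_def)

lemma finite_below [simp]: "finite (below n)"
  by (induction n) (auto simp: below_0 below_Suc)

lemma below_layer_disjoint: "below n \<inter> layer (Suc n) = {}"
  by (auto simp: below_def layer_def)

lemma layer_subset_below: "k \<le> n \<Longrightarrow> layer k \<subseteq> below n"
  by (auto simp: below_def layer_def)

lemma below_subset: "below n \<subseteq> V"
  by (auto simp: below_def)

lemma nn_integral_prod_layers:
  assumes f: "\<And>k. f k \<in> borel_measurable (PiM (layer k) M)"
  shows "(\<integral>\<^sup>+\<sigma>. (\<Prod>k\<le>n. f k (restrict \<sigma> (layer k))) \<partial>PiM (below n) M)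
           = (\<Prod>k\<le>n. \<integral>\<^sup>+\<sigma>. f k \<sigma> \<partial>PiM (layer k) M)"
proof (induction n)
  case 0
  have "(\<integral>\<^sup>+\<sigma>. f 0 (restrict \<sigma> (layer 0)) \<partial>PiM (layer 0) M) = (\<integral>\<^sup>+\<sigma>. f 0 \<sigma> \<partial>PiM (layer 0) M)"
    by (intro nn_integral_cong) (auto simp: space_PiM PiE_restrict)
  then show ?case by (simp add: below_0 del: restrict_apply)
next
  case (Suc n)
  interpret product_sigma_finite M
    by (simp add: product_sigma_finite_def prob_M prob_space_imp_sigma_finite)
  let ?B = "below n" and ?W = "layer (Suc n)"
  have meas: "(\<lambda>\<sigma>. f k (restrict \<sigma> (layer k))) \<in> borel_measurable (PiM (below m) M)"
    if "k \<le> m" for k m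
    by (rule measurable_compose[OF measurable_restrict_subset f])
       (use that layer_subset_below in auto)
  have "(\<integral>\<^sup>+\<sigma>. (\<Prod>k\<le>Suc n. f k (restrict \<sigma> (layer k))) \<partial>PiM (below (Suc n)) M)
     = (\<integral>\<^sup>+x. \<integral>\<^sup>+y. (\<Prod>k\<le>Suc n. f k (restrict (merge ?B ?W (x, y)) (layer k)))
            \<partial>PiM ?W M \<partial>PiM ?B M)"
    unfolding below_Suc
  proof (rule product_nn_integral_fold)
    show "(\<lambda>\<sigma>. \<Prod>k\<le>Suc n. f k (restrict \<sigma> (layer k))) \<in> borel_measurable (PiM (?B \<union> ?W) M)"
      unfolding below_Suc[symmetric] by (intro borel_measurable_prod_ennreal meas) simp
  qed (simp_all add: below_layer_disjoint)
  also have "\<dots> = (\<integral>\<^sup>+x. \<integral>\<^sup>+y. (\<Prod>k\<le>n. f k (restrict x (layer k))) * f (Suc n) y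
            \<partial>PiM ?W M \<partial>PiM ?B M)"
  proof (intro nn_integral_cong)
    fix x y assume x: "x \<in> space (PiM ?B M)" and y: "y \<in> space (PiM ?W M)"
    have "restrict (merge ?B ?W (x, y)) (layer k) = restrict x (layer k)" if "k \<le> n" for k
      using layer_subset_below[OF that] by (intro restrict_ext) (auto simp: merge_def)
    then have 1: "(\<Prod>k\<le>n. f k (restrict (merge ?B ?W (x, y)) (layer k)))
        = (\<Prod>k\<le>n. f k (restrict x (layer k)))"
      by (intro prod.cong refl arg_cong[where f = "f _"]) simp
    have "restrict (merge ?B ?W (x, y)) ?W = restrict y ?W"
      using below_layer_disjoint[of n] by (intro restrict_ext) (auto simp: merge_def)
    also have "\<dots> = y"
      using y by (intro extensional_restrict) (simp add: space_PiM PiE_iff)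
    finally have 2: "f (Suc n) (restrict (merge ?B ?W (x, y)) ?W) = f (Suc n) y"
      by (rule arg_cong)
    show "(\<Prod>k\<le>Suc n. f k (restrict (merge ?B ?W (x, y)) (layer k)))
        = (\<Prod>k\<le>n. f k (restrict x (layer k))) * f (Suc n) y"
      by (simp only: prod.atMost_Suc 1 2)
  qed
  also have "\<dots> = (\<integral>\<^sup>+x. (\<Prod>k\<le>n. f k (restrict x (layer k))) \<partial>PiM ?B M)
        * (\<integral>\<^sup>+y. f (Suc n) y \<partial>PiM ?W M)"
    by (subst nn_integral_cmult, rule f, subst nn_integral_multc)
       (auto intro!: borel_measurable_prod_ennreal meas)
  finally show ?case by (simp only: Suc.IH prod.atMost_Suc)
qed

text \<open>A finite set of coordinates lies in some \<open>below n\<close>, so each cylinder has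
  the same mass under both measures, and cylinders determine a finite measure on the
  product.\<close>

lemma measure_eqI_marginals_below:
  assumes \<mu>: "prob_space \<mu>" "sets \<mu> = sets (PiM V M)" and \<nu>: "sets \<nu> = sets (PiM V M)"
    and eq: "\<And>n. n \<ge> 1 \<Longrightarrow> distr \<mu> (PiM (below n) M) (\<lambda>\<sigma>. restrict \<sigma> (below n))
                 = distr \<nu> (PiM (below n) M) (\<lambda>\<sigma>. restrict \<sigma> (below n))"
  shows "\<mu> = \<nu>"
proof (rule measure_eqI_PiM_infinite)
  show "finite_measure \<mu>" using \<mu>(1) by (simp add: prob_space_def)
  fix A J assume J: "finite J" "J \<subseteq> V" and A: "\<And>i. i \<in> J \<Longrightarrow> A i \<in> sets (M i)"
  \<comment> \<open>The sum bounds \<open>d y\<close> for every \<open>y\<close> in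
    \<open>J\<close>; the successor ensures n \<ge> 1, as \<open>eq\<close> requires.\<close>
  define n where "n = Suc (\<Sum>y\<in>J. d y)"
  have JB: "J \<subseteq> below n"
    using J member_le_sum[of _ J d] by (force simp: below_def n_def intro: le_SucI)
  let ?X = "prod_emb (below n) M J (Pi\<^sub>E J A)"
  have X: "?X \<in> sets (PiM (below n) M)"
    by (rule sets_PiM_I) (use J JB A in auto)
  have *: "emeasure m (prod_emb V M J (Pi\<^sub>E J A))
      = emeasure (distr m (PiM (below n) M) (\<lambda>\<sigma>. restrict \<sigma> (below n))) ?X"
    if m: "sets m = sets (PiM V M)" for m
  proof -
    have "(\<lambda>\<sigma>. restrict \<sigma> (below n)) \<in> measurable m (PiM (below n) M)"
      using measurable_restrict_subset[OF below_subset]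
      by (simp cong: measurable_cong_sets add: m)
    moreover have "(\<lambda>\<sigma>. restrict \<sigma> (below n)) -` ?X \<inter> space m = prod_emb V M J (Pi\<^sub>E J A)"
      using prod_emb_trans[OF JB below_subset, of M "Pi\<^sub>E J A"]
      by (simp add: prod_emb_def[of V M "below n"] sets_eq_imp_space_eq[OF m] space_PiM)
    ultimately show ?thesis by (simp add: emeasure_distr X)
  qed
  show "emeasure \<mu> (prod_emb V M J (Pi\<^sub>E J A)) = emeasure \<nu> (prod_emb V M J (Pi\<^sub>E J A))"
    using eq[of n] by (simp add: *[OF \<mu>(2)] *[OF \<nu>] n_def)
qed (use \<mu> \<nu> in auto)

text \<open>The layers are taken independent with laws of density \<open>g k\<close>. A countable
  product of probability spaces always exists, so no extension theorem for consistent marginals has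
  to be invoked.\<close>

lemma ex_measure_with_layer_densities:
  assumes g: "\<And>k. g k \<in> borel_measurable (PiM (layer k) M)"
    and g1: "\<And>k. (\<integral>\<^sup>+\<sigma>. g k \<sigma> \<partial>PiM (layer k) M) = 1"
  obtains \<mu> where "prob_space \<mu>" "sets \<mu> = sets (PiM V M)"
    "\<And>n. distr \<mu> (PiM (below n) M) (\<lambda>\<sigma>. restrict \<sigma> (below n))
       = density (PiM (below n) M) (\<lambda>\<sigma>. \<Prod>k\<le>n. g k (restrict \<sigma> (layer k)))"
proof -
  define N where "N k = density (PiM (layer k) M) (g k)" for k
  have sets_N: "sets (N k) = sets (PiM (layer k) M)" for k
    by (simp add: N_def)
  have space_N: "space (N k) = space (PiM (layer k) M)" for k
    by (simp add: N_def)
  have probN: "prob_space (N k)" for k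
    unfolding N_def
    by (rule prob_spaceI) (simp add: emeasure_density g g1 nn_integral_set_ennreal cong: nn_integral_cong)
  interpret N: product_prob_space N UNIV
    by (intro product_prob_spaceI probN)
  define P where "P = PiM UNIV N"
  \<comment> \<open>\<open>T\<close> glues a sequence of layer configurations into one
    configuration: the value at \<open>y\<close> is read off in the component of its own layer,
    \<open>d y\<close>.\<close>
  define T where "T \<omega> = (\<lambda>y\<in>V. \<omega> (d y) y)" for \<omega> :: "nat \<Rightarrow> 'v \<Rightarrow> 'a"
  have coord: "(\<lambda>\<omega>. \<omega> (d y) y) \<in> measurable P (M y)" if "y \<in> V" for y
  proof -
    have "(\<lambda>\<omega>. \<omega> (d y)) \<in> measurable P (N (d y))"
      unfolding P_def by (rule measurable_component_singleton) simp
    also have "measurable P (N (d y)) = measurable P (PiM (layer (d y)) M)"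
      by (intro measurable_cong_sets refl sets_N)
    finally show ?thesis
      by (rule measurable_compose[OF _ measurable_component_singleton])
         (use that in \<open>simp add: layer_def\<close>)
  qed
  have T: "T \<in> measurable P (PiM V M)"
    unfolding T_def by (rule measurable_restrict) (rule coord)
  have probP: "prob_space P" unfolding P_def by (rule N.prob_space_axioms)
  define \<mu> where "\<mu> = distr P (PiM V M) T"
  show thesis
  proof (rule that)
    show "prob_space \<mu>" unfolding \<mu>_def by (rule prob_space.prob_space_distr[OF probP T])
    show "sets \<mu> = sets (PiM V M)" by (simp add: \<mu>_def)
    fix n
    let ?B = "below n"
    let ?D = "distr \<mu> (PiM ?B M) (\<lambda>\<sigma>. restrict \<sigma> ?B)"
    have R: "(\<lambda>\<sigma>. restrict \<sigma> ?B) \<in> measurable (PiM V M) (PiM ?B M)"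
      by (rule measurable_restrict_subset[OF below_subset])
    have D: "?D = distr P (PiM ?B M) ((\<lambda>\<sigma>. restrict \<sigma> ?B) \<circ> T)"
      unfolding \<mu>_def by (rule distr_distr[OF R T])
    have probD: "prob_space ?D"
      unfolding D by (rule prob_space.prob_space_distr[OF probP]) (rule measurable_comp[OF T R])
    show "?D = density (PiM ?B M) (\<lambda>\<sigma>. \<Prod>k\<le>n. g k (restrict \<sigma> (layer k)))"
    proof (rule measure_eqI_PiM_finite)
      \<comment> \<open>On a finite product, agreement on boxes suffices once the space is exhausted
        by sets of finite mass; a constant sequence does this because \<open>?D\<close> is a
        probability measure.\<close>
      show "range (\<lambda>_::nat. space (PiM ?B M)) \<subseteq> prod_algebra ?B M"
        by (auto simp: space_PiM intro!: prod_algebraI_finite)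
      show "(\<Union>i::nat. space (PiM ?B M)) = space (PiM ?B M)" by simp
      show "emeasure ?D (space (PiM ?B M)) \<noteq> \<infinity>" for i :: nat
        using prob_space.emeasure_space_1[OF probD] by simp
      fix A assume A: "\<And>i. i \<in> ?B \<Longrightarrow> A i \<in> sets (M i)"
      have boxB: "Pi\<^sub>E ?B A \<in> sets (PiM ?B M)"
        by (rule sets_PiM_I_finite) (use A in auto)
      \<comment> \<open>The empty set for k > n is a dummy value: \<open>A\<close> is measurable
        only on \<open>?B\<close>, while the product formula asks for measurability at every
        \<open>k\<close>.\<close>
      define box where "box k = (if k \<le> n then Pi\<^sub>E (layer k) A else {})" for k
      have box: "box k \<in> sets (PiM (layer k) M)" for k
        unfolding box_def using A layer_subset_below[of k n]
        by (auto intro!: sets_PiM_I_finite)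
      have A_sp: "x \<in> space (M i)" if "i \<in> ?B" "x \<in> A i" for i x
        using A[OF that(1)] that(2) sets.sets_into_space by blast
      have mem: "\<omega> k \<in> extensional (layer k)" "y \<in> layer k \<Longrightarrow> \<omega> k y \<in> space (M y)"
        if "\<omega> \<in> space P" for \<omega> k y
        using that by (auto simp: P_def space_PiM space_N PiE_iff)
      \<comment> \<open>Sorting the conditions on the sites of \<open>?B\<close> by layer turns the
        preimage of a box into a cylinder over the components k \<le> n, whose mass is a
        product.\<close>
      have pre: "((\<lambda>\<sigma>. restrict \<sigma> ?B) \<circ> T) -` Pi\<^sub>E ?B A \<inter> space P
          = prod_emb UNIV N {..n} (Pi\<^sub>E {..n} box)" (is "?L = ?R")
      proof (rule set_eqI)
        fix \<omega>
        have "\<omega> \<in> ?L \<longleftrightarrow> \<omega> \<in> space P \<and> (\<forall>y\<in>?B. \<omega> (d y) y \<in> A y)"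
          using below_subset[of n] by (auto simp: PiE_iff T_def subset_iff)
        also have "\<dots> \<longleftrightarrow> \<omega> \<in> space P \<and> (\<forall>k\<le>n. \<omega> k \<in> box k)"
          by (auto simp: box_def PiE_iff mem) (auto simp: below_def layer_def)
        also have "\<dots> \<longleftrightarrow> \<omega> \<in> ?R"
          by (auto simp: prod_emb_iff P_def space_PiM PiE_iff)
        finally show "\<omega> \<in> ?L \<longleftrightarrow> \<omega> \<in> ?R" .
      qed
      \<comment> \<open>The indicator of a box also factors over the layers, so it can be absorbed
        into the factors integrated by \<open>nn_integral_prod_layers\<close>.\<close>
      have ind: "(\<Prod>k\<le>n. g k (restrict \<sigma> (layer k)) * indicator (box k) (restrict \<sigma> (layer k)))
          = (\<Prod>k\<le>n. g k (restrict \<sigma> (layer k))) * indicator (Pi\<^sub>E ?B A) \<sigma>"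
        if \<sigma>: "\<sigma> \<in> space (PiM ?B M)" for \<sigma>
      proof -
        have "\<sigma> \<in> Pi\<^sub>E ?B A \<longleftrightarrow> (\<forall>k\<le>n. restrict \<sigma> (layer k) \<in> box k)"
          using \<sigma> by (auto simp: box_def PiE_iff space_PiM) (auto simp: below_def layer_def)
        then have "(\<Prod>k\<le>n. indicator (box k) (restrict \<sigma> (layer k))) = (indicator (Pi\<^sub>E ?B A) \<sigma> :: ennreal)"
          by (auto simp: indicator_def)
        then show ?thesis by (simp add: prod.distrib)
      qed
      have "emeasure ?D (Pi\<^sub>E ?B A) = emeasure P (prod_emb UNIV N {..n} (Pi\<^sub>E {..n} box))"
        unfolding D by (subst emeasure_distr[OF measurable_comp[OF T R] boxB]) (simp only: pre)
      also have "\<dots> = (\<Prod>k\<le>n. emeasure (N k) (box k))"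
        unfolding P_def by (rule N.emeasure_PiM_emb) (auto simp: sets_N box)
      also have "\<dots> = (\<Prod>k\<le>n. \<integral>\<^sup>+\<sigma>. g k \<sigma> * indicator (box k) \<sigma> \<partial>PiM (layer k) M)"
        unfolding N_def by (simp add: emeasure_density g box)
      also have "\<dots> = (\<integral>\<^sup>+\<sigma>. (\<Prod>k\<le>n. g k (restrict \<sigma> (layer k)) * indicator (box k) (restrict \<sigma> (layer k)))
                         \<partial>PiM ?B M)"
        by (rule nn_integral_prod_layers[symmetric])
           (intro borel_measurable_times_ennreal g borel_measurable_indicator box)
      also have "\<dots> = (\<integral>\<^sup>+\<sigma>. (\<Prod>k\<le>n. g k (restrict \<sigma> (layer k))) * indicator (Pi\<^sub>E ?B A) \<sigma> \<partial>PiM ?B M)"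
        by (rule nn_integral_cong) (rule ind)
      also have "\<dots> = emeasure (density (PiM ?B M) (\<lambda>\<sigma>. \<Prod>k\<le>n. g k (restrict \<sigma> (layer k)))) (Pi\<^sub>E ?B A)"
        by (rule emeasure_density[symmetric, OF _ boxB])
           (intro borel_measurable_prod_ennreal measurable_compose[OF measurable_restrict_subset g]
              layer_subset_below, simp)
      finally show "emeasure ?D (Pi\<^sub>E ?B A)
          = emeasure (density (PiM ?B M) (\<lambda>\<sigma>. \<Prod>k\<le>n. g k (restrict \<sigma> (layer k)))) (Pi\<^sub>E ?B A)" .
    qed simp_all
  qed
qed

end


section \<open>Spheres of a Cayley tree\<close>

text \<open>Walks are extended at the head, with the end \<open>r\<close> fixed, because
  \<open>graph_dist V L x r\<close> is defined by walks from \<open>x\<close> to the root. Each walk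
  has finitely many extensions by one step.\<close>

lemma finite_walks_to:
  assumes deg: "\<And>x. x \<in> V \<Longrightarrow> finite {y \<in> V. {x, y} \<in> L}"
  shows "finite {xs. walk V L xs \<and> last xs = r \<and> length xs = Suc n}"
proof (induction n)
  case 0
  have "{xs. walk V L xs \<and> last xs = r \<and> length xs = Suc 0} \<subseteq> {[r]}"
    by (auto simp: length_Suc_conv)
  then show ?case by (rule finite_subset) simp
next
  case (Suc n)
  let ?S = "{xs. walk V L xs \<and> last xs = r \<and> length xs = Suc n}"
  have "{xs. walk V L xs \<and> last xs = r \<and> length xs = Suc (Suc n)}
      \<subseteq> (\<Union>xs\<in>?S. (\<lambda>y. y # xs) ` {y \<in> V. {hd xs, y} \<in> L})"
  proof
    fix zs assume "zs \<in> {xs. walk V L xs \<and> last xs = r \<and> length xs = Suc (Suc n)}"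
    then obtain y x xs where "zs = y # x # xs" "walk V L zs" "last zs = r" "length xs = n"
      by (auto simp: length_Suc_conv)
    then have "x # xs \<in> ?S" "y \<in> {y \<in> V. {hd (x # xs), y} \<in> L}" "zs = y # x # xs"
      by (simp_all add: walk_def insert_commute)
    then show "zs \<in> (\<Union>xs\<in>?S. (\<lambda>y. y # xs) ` {y \<in> V. {hd xs, y} \<in> L})"
      by (intro UN_I[of "x # xs"] image_eqI)
  qed
  moreover have "finite (\<Union>xs\<in>?S. (\<lambda>y. y # xs) ` {y \<in> V. {hd xs, y} \<in> L})"
    by (intro finite_UN_I Suc finite_imageI deg) (auto simp: walk_def)
  ultimately show ?case by (rule finite_subset)
qed

text \<open>A vertex at distance \<open>n\<close> is the head of a walk of length \<open>n\<close>
  ending in the root. Connectedness guarantees that the minimum defining the distance is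
  attained.\<close>

lemma finite_sphere_W:
  assumes deg: "\<And>x. x \<in> V \<Longrightarrow> finite {y \<in> V. {x, y} \<in> L}"
    and conn: "connected_graph V L" and r: "r \<in> V"
  shows "finite (sphere_W V L r n)"
proof (rule finite_subset)
  show "sphere_W V L r n \<subseteq> hd ` {xs. walk V L xs \<and> last xs = r \<and> length xs = Suc n}"
  proof
    fix x assume "x \<in> sphere_W V L r n"
    then have x: "x \<in> V" and n: "graph_dist V L x r = n" by (auto simp: sphere_W_def)
    obtain xs where xs: "walk V L xs" "hd xs = x" "last xs = r"
      using conn x r by (auto simp: connected_graph_def)
    then have "length xs = Suc (length xs - 1)" by (cases xs) (auto simp: walk_def)
    then have "\<exists>m xs. walk V L xs \<and> hd xs = x \<and> last xs = r \<and> length xs = Suc m"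
      using xs by blast
    then have "\<exists>xs. walk V L xs \<and> hd xs = x \<and> last xs = r \<and> length xs = Suc n"
      unfolding n[symmetric] graph_dist_def by (rule LeastI_ex)
    then show "x \<in> hd ` {xs. walk V L xs \<and> last xs = r \<and> length xs = Suc n}" by blast
  qed
qed (intro finite_imageI finite_walks_to deg)

lemma cayley_tree_finite_sphere_W:
  assumes "cayley_tree k V L" "r \<in> V"
  shows "finite (sphere_W V L r n)"
proof (rule finite_sphere_W)
  show "finite {y \<in> V. {x, y} \<in> L}" if "x \<in> V" for x
    \<comment> \<open>An infinite set has \<open>card\<close> equal to 0, so the positive value
      \<open>k + 1\<close> forces finiteness.\<close>
    using assms that by (intro card_ge_0_finite) (auto simp: cayley_tree_def)
qed (use assms in \<open>auto simp: cayley_tree_def tree_graph_def\<close>)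


section \<open>The model\<close>

abbreviation spin_measure :: "real measure" where
  "spin_measure \<equiv> restrict_space lborel {0..1}"

lemma prob_space_spin_measure: "prob_space spin_measure"
  by (rule prob_space_restrict_space) auto

lemma space_spin_space: "space (spin_space A) = A \<rightarrow>\<^sub>E {0..1}"
  by (simp add: spin_space_def space_PiM space_restrict_space)

lemma prob_space_spin_space: "prob_space (spin_space A)"
  unfolding spin_space_def by (intro prob_space_PiM prob_space_spin_measure)

lemma spin_borel_measurable:
  assumes "y \<in> A" shows "(\<lambda>\<sigma>. \<sigma> y) \<in> borel_measurable (spin_space A)"
  unfolding spin_space_def
  by (rule measurable_compose[OF measurable_component_singleton[OF assms]])
     (simp add: measurable_restrict_space1)

locale rooted_model =
  fixes V :: "'v set" and L :: "'v set set" and r :: 'v and J \<alpha> \<beta> :: real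
  assumes finite_W: "\<And>n. finite (sphere_W V L r n)"
begin

sublocale layered_family "\<lambda>_. spin_measure" V "\<lambda>y. graph_dist V L y r"
  by (rule layered_family.intro) (rule prob_space_spin_measure, fold sphere_W_def, rule finite_W)

lemma layer_eq: "layer n = sphere_W V L r n"
  by (simp add: layer_def sphere_W_def)

lemma below_eq: "below n = ball_V V L r n"
  by (simp add: below_def ball_V_def)

abbreviation "W \<equiv> sphere_W V L r"
abbreviation "B \<equiv> ball_V V L r"
abbreviation "S \<equiv> successors V L r"
abbreviation "H \<equiv> hamiltonian V L r J \<alpha>"
abbreviation "weight \<equiv> gibbs_weight V L r J \<alpha> \<beta>"
abbreviation "Z \<equiv> partition_function V L r J \<alpha> \<beta>"
abbreviation "dens \<equiv> gibbs_density V L r J \<alpha> \<beta>"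

section \<open>Decomposition of the energy into spheres\<close>

text \<open>Second-neighbour pairs in \<open>W (Suc j)\<close> are indexed by their common predecessor in \<open>W j\<close>.\<close>

definition sphere_energy :: "nat \<Rightarrow> ('v \<Rightarrow> real) \<Rightarrow> real" where
  "sphere_energy k \<sigma> =
     - J * (case k of 0 \<Rightarrow> 0 | Suc j \<Rightarrow> \<Sum>x\<in>W j. \<Sum>p | p \<subseteq> S x \<and> card p = 2. \<Prod>y\<in>p. \<sigma> y)
     - \<alpha> * (\<Sum>x\<in>W k. \<sigma> x)"

lemma successors_subset: "x \<in> W j \<Longrightarrow> S x \<subseteq> W (Suc j)"
  by (auto simp: successors_def sphere_W_def)

lemma sum_ball: "(\<Sum>x\<in>B n. g x) = (\<Sum>k\<le>n. \<Sum>x\<in>W k. g x)" for g :: "'v \<Rightarrow> real"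
  unfolding below_eq[symmetric] layer_eq[symmetric]
  by (induction n) (simp_all add: below_0 below_Suc sum.union_disjoint below_layer_disjoint)

text \<open>At \<open>n = 0\<close> the truncated subtraction in the Hamiltonian adds pairs outside the ball,
  hence \<open>n \<ge> 1\<close> here and below.\<close>

lemma hamiltonian_eq_sum_spheres:
  assumes "n \<ge> 1" shows "H n \<sigma> = (\<Sum>k\<le>n. sphere_energy k \<sigma>)"
proof -
  obtain m where n: "n = Suc m" using assms by (cases n) auto
  let ?pairs = "\<lambda>x. \<Sum>p | p \<subseteq> S x \<and> card p = 2. \<Prod>y\<in>p. \<sigma> y"
  \<comment> \<open>Index shift: pairs in sphere \<open>Suc j\<close> belong to predecessors in
    sphere \<open>j\<close>, so the spheres up to \<open>Suc m\<close> use exactly the predecessors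
    in the ball of radius \<open>m\<close>.\<close>
  have "(\<Sum>k\<le>Suc m. case k of 0 \<Rightarrow> 0 | Suc j \<Rightarrow> \<Sum>x\<in>W j. ?pairs x) = (\<Sum>k\<le>m. \<Sum>x\<in>W k. ?pairs x)"
    by (subst sum.atMost_Suc_shift) simp
  moreover have "H n \<sigma> = - J * (\<Sum>k\<le>m. \<Sum>x\<in>W k. ?pairs x) - \<alpha> * (\<Sum>k\<le>Suc m. \<Sum>x\<in>W k. \<sigma> x)"
    by (simp only: n hamiltonian_def sum_ball diff_Suc_1)
  moreover have "(\<Sum>k\<le>Suc m. sphere_energy k \<sigma>)
      = - J * (\<Sum>k\<le>Suc m. case k of 0 \<Rightarrow> 0 | Suc j \<Rightarrow> \<Sum>x\<in>W j. ?pairs x)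
        - \<alpha> * (\<Sum>k\<le>Suc m. \<Sum>x\<in>W k. \<sigma> x)"
    by (simp only: sphere_energy_def sum_subtractf
        sum_distrib_left[where r = "- J"] sum_distrib_left[where r = \<alpha> and A = "{..Suc m}"])
  ultimately show ?thesis by (simp only: n)
qed

text \<open>The predecessor serves only as an index; the spins that occur sit on its successors,
  hence in the sphere \<open>W k\<close> itself. This locality is what makes the spheres
  independent.\<close>

lemma sphere_energy_cong:
  assumes "\<And>y. y \<in> W k \<Longrightarrow> \<sigma> y = \<tau> y"
  shows "sphere_energy k \<sigma> = sphere_energy k \<tau>"
  unfolding sphere_energy_def using assms successors_subset
  by (intro arg_cong2[where f = "(-)"] arg_cong2[where f = "(*)"] refl sum.cong)
     (auto split: nat.splits intro!: sum.cong prod.cong, blast)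

lemma sphere_energy_measurable:
  assumes "W k \<subseteq> A"
  shows "sphere_energy k \<in> borel_measurable (spin_space A)"
proof (cases k)
  case 0
  then show ?thesis
    unfolding sphere_energy_def using assms
    by (auto intro!: borel_measurable_times borel_measurable_diff borel_measurable_sum spin_borel_measurable)
next
  case (Suc j)
  have "S x \<subseteq> A" if "x \<in> W j" for x
    using successors_subset[OF that] assms Suc by auto
  then show ?thesis
    unfolding sphere_energy_def using assms Suc
    by (auto intro!: borel_measurable_times borel_measurable_diff borel_measurable_sum
        borel_measurable_prod spin_borel_measurable, blast)
qed

lemma sphere_energy_bounded:
  obtains C where "\<And>\<sigma>. \<sigma> \<in> space (spin_space (W k)) \<Longrightarrow> \<bar>sphere_energy k \<sigma>\<bar> \<le> C"
proof
  fix \<sigma> assume "\<sigma> \<in> space (spin_space (W k))"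
  then have \<sigma>: "0 \<le> \<sigma> y" "\<sigma> y \<le> 1" if "y \<in> W k" for y
    using that by (auto simp: space_spin_space PiE_iff)
  let ?pairs = "\<lambda>x. {p. p \<subseteq> S x \<and> card p = 2}"
  \<comment> \<open>Spins lie in [0,1], so every pair product is at most 1 in absolute value and
    \<open>c\<close> simply counts the pairs.\<close>
  define c :: real where "c = (case k of 0 \<Rightarrow> 0 | Suc j \<Rightarrow> \<Sum>x\<in>W j. \<Sum>p\<in>?pairs x. 1)"
  have 1: "\<bar>case k of 0 \<Rightarrow> 0 | Suc j \<Rightarrow> \<Sum>x\<in>W j. \<Sum>p\<in>?pairs x. \<Prod>y\<in>p. \<sigma> y\<bar> \<le> c"
  proof (cases k)
    case (Suc j)
    have "\<bar>\<Prod>y\<in>p. \<sigma> y\<bar> \<le> 1" if "x \<in> W j" "p \<in> ?pairs x" for x p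
    proof -
      have "y \<in> W k" if "y \<in> p" for y
        using successors_subset[OF \<open>x \<in> W j\<close>] \<open>p \<in> ?pairs x\<close> that Suc by auto
      then show ?thesis
        unfolding abs_prod by (intro prod_le_1) (use \<sigma> in auto)
    qed
    then show ?thesis
      unfolding c_def Suc nat.case by (intro order_trans[OF sum_abs] sum_mono) 
  qed (simp add: c_def)
  have 2: "\<bar>\<Sum>x\<in>W k. \<sigma> x\<bar> \<le> (\<Sum>x\<in>W k. 1)"
    by (intro order_trans[OF sum_abs] sum_mono) (use \<sigma> in auto)
  show "\<bar>sphere_energy k \<sigma>\<bar> \<le> \<bar>J\<bar> * (case k of 0 \<Rightarrow> 0 | Suc j \<Rightarrow> \<Sum>x\<in>W j. \<Sum>p\<in>?pairs x. 1)
       + \<bar>\<alpha>\<bar> * (\<Sum>x\<in>W k. 1)"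
    unfolding sphere_energy_def c_def[symmetric]
    using mult_left_mono[OF 1, of "\<bar>J\<bar>"] mult_left_mono[OF 2, of "\<bar>\<alpha>\<bar>"]
    by (intro order_trans[OF abs_triangle_ineq4] add_mono) (auto simp: abs_mult)
qed

section \<open>Partition functions of single spheres and the zero-field weight\<close>

definition sphere_Z :: "nat \<Rightarrow> real" where
  "sphere_Z k = (\<integral>\<sigma>. exp (- \<beta> * sphere_energy k \<sigma>) \<partial>spin_space (W k))"

lemma sphere_weight_measurable:
  "(\<lambda>\<sigma>. exp (- \<beta> * sphere_energy k \<sigma>)) \<in> borel_measurable (spin_space (W k))"
  by (rule measurable_compose[OF sphere_energy_measurable[OF order_refl]]) measurable

lemma sphere_weight_integrable:
  "integrable (spin_space (W k)) (\<lambda>\<sigma>. exp (- \<beta> * sphere_energy k \<sigma>))"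
proof -
  obtain C where C: "\<And>\<sigma>. \<sigma> \<in> space (spin_space (W k)) \<Longrightarrow> \<bar>sphere_energy k \<sigma>\<bar> \<le> C"
    using sphere_energy_bounded by blast
  interpret prob_space "spin_space (W k)" by (rule prob_space_spin_space)
  show ?thesis
  proof (rule integrable_const_bound[OF _ sphere_weight_measurable])
    have "- \<beta> * sphere_energy k \<sigma> \<le> \<bar>\<beta>\<bar> * C" if "\<sigma> \<in> space (spin_space (W k))" for \<sigma>
      using abs_le_D1[of "- \<beta> * sphere_energy k \<sigma>"] mult_left_mono[OF C[OF that], of "\<bar>\<beta>\<bar>"]
      by (simp add: abs_mult)
    then show "AE \<sigma> in spin_space (W k). norm (exp (- \<beta> * sphere_energy k \<sigma>)) \<le> exp (\<bar>\<beta>\<bar> * C)"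
      by (intro AE_I2) auto
  qed
qed

text \<open>A strictly positive integrable function on a probability space has positive integral.
  Positivity allows these constants to be divided by and cancelled.\<close>

lemma sphere_Z_pos: "sphere_Z k > 0"
proof -
  interpret prob_space "spin_space (W k)" by (rule prob_space_spin_space)
  have "(\<integral>\<sigma>. 0 \<partial>spin_space (W k)) < sphere_Z k"
    unfolding sphere_Z_def
    by (rule integral_less_AE_space[OF _ sphere_weight_integrable]) (auto simp: emeasure_space_1)
  then show ?thesis by simp
qed

lemma nn_integral_sphere_weight:
  "(\<integral>\<^sup>+\<sigma>. ennreal (exp (- \<beta> * sphere_energy k \<sigma>)) \<partial>spin_space (W k)) = ennreal (sphere_Z k)"
  unfolding sphere_Z_def by (rule nn_integral_eq_integral[OF sphere_weight_integrable]) simp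

text \<open>The exponential turns the sum over spheres into a product. By locality each factor may
  be evaluated at a restriction, which is the form \<open>nn_integral_prod_layers\<close>
  expects.\<close>

lemma weight_zero_eq_prod:
  assumes "n \<ge> 1"
  shows "weight (\<lambda>_ _. 0) n \<sigma> = (\<Prod>k\<le>n. exp (- \<beta> * sphere_energy k (restrict \<sigma> (W k))))"
proof -
  have "sphere_energy k (restrict \<sigma> (W k)) = sphere_energy k \<sigma>" for k
    by (rule sphere_energy_cong) simp
  then show ?thesis
    unfolding gibbs_weight_def hamiltonian_eq_sum_spheres[OF assms]
    by (simp only: sum_distrib_left exp_sum finite_atMost sum.neutral_const add_0_right)
qed

lemma weight_zero_measurable:
  assumes "n \<ge> 1"
  shows "weight (\<lambda>_ _. 0) n \<in> borel_measurable (spin_space (B n))"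
proof -
  have "W k \<subseteq> B n" if "k \<le> n" for k
    using that by (auto simp: ball_V_def sphere_W_def)
  then show ?thesis
    unfolding gibbs_weight_def hamiltonian_eq_sum_spheres[OF assms]
    by (intro measurable_compose[OF _ borel_measurable_exp] borel_measurable_times borel_measurable_const
        borel_measurable_add borel_measurable_sum sphere_energy_measurable) auto
qed

text \<open>The product formula concerns nonnegative integrals, so the value is computed there and
  carried back to the Bochner integral by \<open>enn2real\<close>.\<close>

lemma Z_zero_eq_prod:
  assumes "n \<ge> 1" shows "Z (\<lambda>_ _. 0) n = (\<Prod>k\<le>n. sphere_Z k)"
proof -
  have "(\<integral>\<^sup>+\<sigma>. ennreal (weight (\<lambda>_ _. 0) n \<sigma>) \<partial>spin_space (B n))
      = (\<integral>\<^sup>+\<sigma>. (\<Prod>k\<le>n. ennreal (exp (- \<beta> * sphere_energy k (restrict \<sigma> (W k))))) \<partial>spin_space (B n))"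
    by (simp add: weight_zero_eq_prod[OF assms] prod_ennreal)
  also have "\<dots> = (\<Prod>k\<le>n. \<integral>\<^sup>+\<sigma>. ennreal (exp (- \<beta> * sphere_energy k \<sigma>)) \<partial>spin_space (W k))"
    using nn_integral_prod_layers[of "\<lambda>k \<sigma>. ennreal (exp (- \<beta> * sphere_energy k \<sigma>))" n] sphere_weight_measurable
    by (simp add: layer_eq below_eq spin_space_def)
  also have "\<dots> = ennreal (\<Prod>k\<le>n. sphere_Z k)"
    unfolding nn_integral_sphere_weight by (rule prod_ennreal) (simp add: sphere_Z_pos less_imp_le)
  finally have *: "(\<integral>\<^sup>+\<sigma>. ennreal (weight (\<lambda>_ _. 0) n \<sigma>) \<partial>spin_space (B n)) = ennreal (\<Prod>k\<le>n. sphere_Z k)" .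
  have "Z (\<lambda>_ _. 0) n = enn2real (\<integral>\<^sup>+\<sigma>. ennreal (weight (\<lambda>_ _. 0) n \<sigma>) \<partial>spin_space (B n))"
    unfolding partition_function_def
    by (rule integral_eq_nn_integral[OF weight_zero_measurable[OF assms]]) (simp add: gibbs_weight_def)
  then show ?thesis
    by (simp add: * prod_nonneg sphere_Z_pos less_imp_le)
qed

section \<open>Integrating out the outermost sphere\<close>

lemma weight_merge:
  assumes "n \<ge> 1"
  shows "weight h (Suc n) (merge (B n) (W (Suc n)) (\<sigma>, \<omega>)) =
     weight (\<lambda>_ _. 0) n \<sigma> * (exp (- \<beta> * sphere_energy (Suc n) \<omega>) * exp (\<Sum>x\<in>W (Suc n). h (\<omega> x) x))"
proof -
  let ?m = "merge (B n) (W (Suc n)) (\<sigma>, \<omega>)"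
  have m1: "?m y = \<sigma> y" if "y \<in> B n" for y using that by (simp add: merge_def)
  have m2: "?m y = \<omega> y" if "y \<in> W (Suc n)" for y
    using that by (auto simp: merge_def ball_V_def sphere_W_def)
  have "sphere_energy k ?m = sphere_energy k \<sigma>" if "k \<le> n" for k
    by (rule sphere_energy_cong, rule m1) (use that in \<open>auto simp: ball_V_def sphere_W_def\<close>)
  moreover have "sphere_energy (Suc n) ?m = sphere_energy (Suc n) \<omega>"
    by (rule sphere_energy_cong) (rule m2)
  ultimately have "H (Suc n) ?m = H n \<sigma> + sphere_energy (Suc n) \<omega>"
    by (simp add: hamiltonian_eq_sum_spheres[OF assms] hamiltonian_eq_sum_spheres[of "Suc n"])
  \<comment> \<open>The field acts on the outermost sphere only, so the factor left on the ball is
    the zero-field weight whatever \<open>h\<close> is.\<close>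
  moreover have "(\<Sum>x\<in>W (Suc n). h (?m x) x) = (\<Sum>x\<in>W (Suc n). h (\<omega> x) x)"
    by (intro sum.cong refl) (simp add: m2)
  ultimately show ?thesis
    by (simp add: gibbs_weight_def ring_distribs flip: exp_add)
qed

text \<open>The inner configuration enters through a factor that is constant under the integral. The
  identity needs no integrability: a non-integrable outer factor gives 0 on both sides.\<close>

lemma integral_density_merge:
  assumes "n \<ge> 1"
  shows "(\<integral>\<omega>. dens h (Suc n) (merge (B n) (W (Suc n)) (\<sigma>, \<omega>)) \<partial>spin_space (W (Suc n))) =
    weight (\<lambda>_ _. 0) n \<sigma> *
     ((\<integral>\<omega>. exp (- \<beta> * sphere_energy (Suc n) \<omega>) * exp (\<Sum>x\<in>W (Suc n). h (\<omega> x) x) \<partial>spin_space (W (Suc n)))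
       / Z h (Suc n))"
  by (simp add: gibbs_density_def weight_merge[OF assms])

text \<open>Integrating out a sphere produces \<open>sphere_Z (Suc m)\<close>, which is exactly the
  quotient of consecutive zero-field partition functions.\<close>

lemma compatible_zero: "compatible V L r J \<alpha> \<beta> (\<lambda>_ _. 0)"
  unfolding compatible_def
proof (intro allI impI ballI)
  fix n :: nat and \<sigma> assume "2 \<le> n"
  then obtain m where n: "n = Suc m" "m \<ge> 1" by (cases n) auto
  have "(\<integral>\<omega>. exp (- \<beta> * sphere_energy (Suc m) \<omega>) * exp (\<Sum>x\<in>W (Suc m). 0) \<partial>spin_space (W (Suc m)))
      = sphere_Z (Suc m)"
    by (simp add: sphere_Z_def)
  then have "(\<integral>\<omega>. dens (\<lambda>_ _. 0) (Suc m) (merge (B m) (W (Suc m)) (\<sigma>, \<omega>)) \<partial>spin_space (W (Suc m)))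
      = weight (\<lambda>_ _. 0) m \<sigma> * (sphere_Z (Suc m) / Z (\<lambda>_ _. 0) (Suc m))"
    by (simp only: integral_density_merge[OF n(2)])
  also have "\<dots> = dens (\<lambda>_ _. 0) m \<sigma>"
    using sphere_Z_pos[of "Suc m"] n(2) by (simp add: gibbs_density_def Z_zero_eq_prod)
  finally show "(\<integral>\<omega>. dens (\<lambda>_ _. 0) n (merge (B (n - 1)) (W n) (\<sigma>, \<omega>)) \<partial>spin_space (W n))
      = dens (\<lambda>_ _. 0) (n - 1) \<sigma>"
    by (simp only: n(1) diff_Suc_1)
qed

text \<open>Because integrating out the outermost sphere contributes only a factor independent of
  the inner spins, compatibility forces \<open>\<Sum>x\<in>W n. h (\<sigma> x) x\<close> to be constant in \<open>\<sigma>\<close>.\<close>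

lemma density_eq_density_zero:
  assumes comp: "compatible V L r J \<alpha> \<beta> h" and Z: "Z h n \<noteq> 0" and n: "n \<ge> 1"
    and \<sigma>: "\<sigma> \<in> B n \<rightarrow>\<^sub>E {0..1}"
  shows "dens h n \<sigma> = dens (\<lambda>_ _. 0) n \<sigma>"
proof -
  \<comment> \<open>\<open>c\<close> is the configuration-independent ratio between the weight with
    field \<open>h\<close> and the zero-field weight.\<close>
  define c where "c = Z h n * ((\<integral>\<omega>. exp (- \<beta> * sphere_energy (Suc n) \<omega>) * exp (\<Sum>x\<in>W (Suc n). h (\<omega> x) x)
      \<partial>spin_space (W (Suc n))) / Z h (Suc n))"
  have w: "weight h n \<tau> = weight (\<lambda>_ _. 0) n \<tau> * c" if "\<tau> \<in> B n \<rightarrow>\<^sub>E {0..1}" for \<tau>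
  proof -
    have "(\<integral>\<omega>. dens h (Suc n) (merge (B n) (W (Suc n)) (\<tau>, \<omega>)) \<partial>spin_space (W (Suc n))) = dens h n \<tau>"
      \<comment> \<open>Level \<open>n\<close> is controlled by compatibility at level
        \<open>Suc n\<close>, so n = 1 is covered too.\<close>
      using comp that n unfolding compatible_def by (elim allE[of _ "Suc n"]) simp
    then have "weight h n \<tau> / Z h n = weight (\<lambda>_ _. 0) n \<tau> * (c / Z h n)"
      unfolding integral_density_merge[OF n] c_def using Z by (simp add: gibbs_density_def)
    then show ?thesis using Z by (simp add: field_simps)
  qed
  \<comment> \<open>Integrating the weight identity shows that the partition functions have the same
    ratio \<open>c\<close>. It is nonzero since \<open>Z h n\<close> is, and cancels in the
    density.\<close>
  have "Z h n = (\<integral>\<tau>. weight (\<lambda>_ _. 0) n \<tau> * c \<partial>spin_space (B n))"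
    unfolding partition_function_def by (intro Bochner_Integration.integral_cong refl w) (simp add: space_spin_space)
  also have "\<dots> = Z (\<lambda>_ _. 0) n * c"
    by (simp add: partition_function_def)
  finally show ?thesis
    using w[OF \<sigma>] Z by (simp add: gibbs_density_def)
qed

section \<open>Marginals of splitting Gibbs measures and uniqueness\<close>

lemma corresponds_to_Z_nonzero:
  assumes "corresponds_to V L r J \<alpha> \<beta> h \<mu>" "n \<ge> 1"
  shows "Z h n \<noteq> 0"
proof
  \<comment> \<open>Division by zero yields 0, so a vanishing partition function would give the
    marginal density 0, whereas the marginal is a probability measure.\<close>
  assume Z: "Z h n = 0"
  let ?D = "distr \<mu> (spin_space (B n)) (\<lambda>\<sigma>. restrict \<sigma> (B n))"
  have \<mu>: "prob_space \<mu>" and s: "sets \<mu> = sets (spin_space V)"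
    and D: "?D = density (spin_space (B n)) (\<lambda>\<sigma>. ennreal (dens h n \<sigma>))"
    using assms by (auto simp: corresponds_to_def)
  have "(\<lambda>\<sigma>. restrict \<sigma> (B n)) \<in> measurable \<mu> (spin_space (B n))"
    using measurable_restrict_subset[OF below_subset[of n], of "\<lambda>_. spin_measure"]
    by (simp add: below_eq spin_space_def s cong: measurable_cong_sets)
  then have "prob_space ?D"
    by (rule prob_space.prob_space_distr[OF \<mu>])
  then have "emeasure ?D (space ?D) = 1" by (rule prob_space.emeasure_space_1)
  moreover have "emeasure ?D (space ?D) = 0"
    unfolding D by (simp add: gibbs_density_def Z emeasure_density)
  ultimately show False by simp
qed

lemma corresponds_to_marginal:
  assumes comp: "compatible V L r J \<alpha> \<beta> h" and cor: "corresponds_to V L r J \<alpha> \<beta> h \<mu>" and n: "n \<ge> 1"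
  shows "distr \<mu> (spin_space (B n)) (\<lambda>\<sigma>. restrict \<sigma> (B n))
    = density (spin_space (B n)) (\<lambda>\<sigma>. ennreal (dens (\<lambda>_ _. 0) n \<sigma>))"
proof -
  have eq: "ennreal (dens h n \<sigma>) = ennreal (dens (\<lambda>_ _. 0) n \<sigma>)" if "\<sigma> \<in> space (spin_space (B n))" for \<sigma>
    using density_eq_density_zero[OF comp corresponds_to_Z_nonzero[OF cor n] n] that
    by (simp add: space_spin_space)
  have meas: "(\<lambda>\<sigma>. ennreal (dens (\<lambda>_ _. 0) n \<sigma>)) \<in> borel_measurable (spin_space (B n))"
    unfolding gibbs_density_def using weight_zero_measurable[OF n]
    by (intro measurable_compose[OF _ measurable_ennreal] borel_measurable_divide borel_measurable_const)
  have "density (spin_space (B n)) (\<lambda>\<sigma>. ennreal (dens h n \<sigma>))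
      = density (spin_space (B n)) (\<lambda>\<sigma>. ennreal (dens (\<lambda>_ _. 0) n \<sigma>))"
    \<comment> \<open>Measurability of the density with field \<open>h\<close> is inherited from the
      zero-field density, with which it agrees on the whole space.\<close>
    by (rule density_cong) (use eq meas in \<open>auto cong: measurable_cong\<close>)
  then show ?thesis using cor n by (simp add: corresponds_to_def)
qed

text \<open>The two measures may come from different fields, but both have the zero-field marginals
  on all balls.\<close>

lemma splitting_gibbs_measure_unique:
  assumes "splitting_gibbs_measure V L r J \<alpha> \<beta> \<mu>" "splitting_gibbs_measure V L r J \<alpha> \<beta> \<nu>"
  shows "\<mu> = \<nu>"
proof -
  obtain h where h: "compatible V L r J \<alpha> \<beta> h" "corresponds_to V L r J \<alpha> \<beta> h \<mu>"
    using assms(1) by (auto simp: splitting_gibbs_measure_def)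
  obtain g where g: "compatible V L r J \<alpha> \<beta> g" "corresponds_to V L r J \<alpha> \<beta> g \<nu>"
    using assms(2) by (auto simp: splitting_gibbs_measure_def)
  show ?thesis
  proof (rule measure_eqI_marginals_below)
    show "prob_space \<mu>" "sets \<mu> = sets (PiM V (\<lambda>_. spin_measure))" "sets \<nu> = sets (PiM V (\<lambda>_. spin_measure))"
      using h g by (auto simp: corresponds_to_def spin_space_def)
    fix n :: nat assume "n \<ge> 1"
    then show "distr \<mu> (PiM (below n) (\<lambda>_. spin_measure)) (\<lambda>\<sigma>. restrict \<sigma> (below n))
        = distr \<nu> (PiM (below n) (\<lambda>_. spin_measure)) (\<lambda>\<sigma>. restrict \<sigma> (below n))"
      using corresponds_to_marginal[OF h] corresponds_to_marginal[OF g]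
      by (simp add: below_eq spin_space_def)
  qed
qed

section \<open>Existence, with zero field\<close>

lemma ex_splitting_gibbs_measure: "\<exists>\<mu>. splitting_gibbs_measure V L r J \<alpha> \<beta> \<mu>"
proof -
  \<comment> \<open>\<open>g k\<close> is the normalized Boltzmann weight of one sphere, hence a
    probability density.\<close>
  define g where "g k \<sigma> = ennreal (exp (- \<beta> * sphere_energy k \<sigma>) / sphere_Z k)" for k \<sigma>
  have g: "g k \<in> borel_measurable (PiM (layer k) (\<lambda>_. spin_measure))" for k
    unfolding g_def layer_eq spin_space_def[symmetric] using sphere_weight_measurable
    by (intro measurable_compose[OF _ measurable_ennreal] borel_measurable_divide borel_measurable_const)
  have "(\<integral>\<^sup>+\<sigma>. g k \<sigma> \<partial>spin_space (W k)) = 1" for k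
  proof -
    have "(\<integral>\<^sup>+\<sigma>. g k \<sigma> \<partial>spin_space (W k))
       = ennreal (\<integral>\<sigma>. exp (- \<beta> * sphere_energy k \<sigma>) / sphere_Z k \<partial>spin_space (W k))"
      unfolding g_def using sphere_weight_integrable sphere_Z_pos[of k]
      by (intro nn_integral_eq_integral integrable_divide) (auto simp: less_imp_le)
    also have "\<dots> = 1" using sphere_Z_pos[of k] by (simp add: sphere_Z_def)
    finally show ?thesis .
  qed
  then have g1: "(\<integral>\<^sup>+\<sigma>. g k \<sigma> \<partial>PiM (layer k) (\<lambda>_. spin_measure)) = 1" for k
    by (simp add: layer_eq spin_space_def)
  obtain \<mu> where \<mu>: "prob_space \<mu>" "sets \<mu> = sets (PiM V (\<lambda>_. spin_measure))"
    and marg: "\<And>n. distr \<mu> (PiM (below n) (\<lambda>_. spin_measure)) (\<lambda>\<sigma>. restrict \<sigma> (below n))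
       = density (PiM (below n) (\<lambda>_. spin_measure)) (\<lambda>\<sigma>. \<Prod>k\<le>n. g k (restrict \<sigma> (layer k)))"
    using ex_measure_with_layer_densities[OF g g1] by blast
  \<comment> \<open>The normalizing constants of the spheres multiply to the partition function of
    the ball, so the product measure has the required marginals.\<close>
  have "(\<Prod>k\<le>n. g k (restrict \<sigma> (W k))) = ennreal (dens (\<lambda>_ _. 0) n \<sigma>)" if "n \<ge> 1" for n \<sigma>
    unfolding g_def gibbs_density_def weight_zero_eq_prod[OF that] Z_zero_eq_prod[OF that]
    by (simp add: prod_ennreal prod_dividef sphere_Z_pos less_imp_le)
  then have "corresponds_to V L r J \<alpha> \<beta> (\<lambda>_ _. 0) \<mu>"
    unfolding corresponds_to_def using \<mu> marg by (simp add: spin_space_def layer_eq below_eq)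
  moreover have "boundary_field V r (\<lambda>_ _. 0)"
    by (auto simp: boundary_field_def image_constant_conv)
  ultimately show ?thesis
    using compatible_zero by (auto simp: splitting_gibbs_measure_def)
qed

end

theorem proposition3p4:
  fixes V :: "'v set" and L :: "'v set set" and x0 :: 'v
    and J \<alpha> \<beta> :: real
  assumes "cayley_tree 2 V L" and "x0 \<in> V"
    and "J \<noteq> 0" and "\<beta> > 0"
  shows "\<exists>!\<mu>. splitting_gibbs_measure V L x0 J \<alpha> \<beta> \<mu>"
proof -
  interpret rooted_model V L x0 J \<alpha> \<beta>
    by (rule rooted_model.intro[OF cayley_tree_finite_sphere_W[OF assms(1,2)]])
  show ?thesis
    using ex_splitting_gibbs_measure splitting_gibbs_measure_unique by blast
qed

end
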